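(* Let $k\ge1$ and $n\ge0$ be integers. The following identity of polynomials in $x_1,\dots,x_k$ (with rational coefficients) holds: $$\prod_{1\le i<j\le k}(x_j-x_i)\cdot\left(\sum_{i=1}^k x_i-\frac{k(k-1)}2\right)^{\underline{n}}=\sum_{n_1+\dots+n_k=n+k(k-1)/2}\frac{n!}{\prod_{i=1}^k n_i!}\prod_{1\le i<j\le k}(n_j-n_i)\cdot\prod_{i=1}^k x_i^{\underline{n_i}},$$ where the sum is over $k$-tuples of non-negative integers $(n_1,\dots,n_k)$ with the indicated sum.
   Context: Falling factorial: $x^{\underline{n}}=x(x-1)\cdots(x-n+1)$, $x^{\underline{0}}=1$. *)

theory Defs
  imports Complex_Main "HOL-Library.FuncSet" "HOL-Library.Poly_Mapping"
begin

text \<open>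
  Multivariate polynomials over the rationals in variables indexed by the natural numbers: an
  exponent vector is a finitely supported function \<open>nat \<Rightarrow>\<^sub>0 nat\<close>, and a polynomial is a
  finitely supported map from exponent vectors to coefficients, with convolution as product.
  The polynomials in \<open>k\<close> variables are those that only involve \<open>X 1, \<dots>, X k\<close>.
\<close>

type_synonym rat_mpoly = "(nat \<Rightarrow>\<^sub>0 nat) \<Rightarrow>\<^sub>0 rat"

definition X :: "nat \<Rightarrow> rat_mpoly" where
  "X i = Poly_Mapping.single (Poly_Mapping.single i 1) 1"

definition Const :: "rat \<Rightarrow> rat_mpoly" where
  "Const c = Poly_Mapping.single 0 c"

definition ffact :: "'a::comm_ring_1 \<Rightarrow> nat \<Rightarrow> 'a" where
  "ffact x n = (\<Prod>i<n. x - of_nat i)"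

text \<open>
  A \<open>k\<close>-tuple of natural numbers is a function that is \<^const>\<open>undefined\<close> outside \<open>{1..k}\<close>,
  so that distinct members of this set are distinct tuples.
\<close>

definition tuples_with_sum :: "nat \<Rightarrow> nat \<Rightarrow> (nat \<Rightarrow> nat) set" where
  "tuples_with_sum k s = {m \<in> {1..k} \<rightarrow>\<^sub>E UNIV. (\<Sum>i=1..k. m i) = s}"

lemma finite_tuples_with_sum: "finite (tuples_with_sum k s)"
proof (rule finite_subset)
  show "tuples_with_sum k s \<subseteq> {1..k} \<rightarrow>\<^sub>E {..s}"
  proof
    fix m assume m: "m \<in> tuples_with_sum k s"
    have "m i \<le> s" if "i \<in> {1..k}" for i
      using member_le_sum[of i "{1..k}" m] m that by (auto simp: tuples_with_sum_def)
    then show "m \<in> {1..k} \<rightarrow>\<^sub>E {..s}"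
      using m by (auto simp: tuples_with_sum_def PiE_iff)
  qed
  show "finite ({1..k} \<rightarrow>\<^sub>E {..s})"
    by (intro finite_PiE) auto
qed

end

theory Submission
  imports Defs "Jordan_Normal_Form.Determinant"
begin

text \<open>
  Column operations turn the Vandermonde matrix into one with entries \<open>ffact (x i) j\<close> without
  changing its determinant, so (\<open>vandermonde_ffact\<close>)
  \[\prod_{i<j} (x_j - x_i) = \sum_p \mathrm{sgn}(p) \prod_i x_i^{\underline{p(i)}},\]
  where \<open>p\<close> runs over the bijections from the indices onto \<open>{0..<k}\<close>. The exponents of every
  summand add up to \<open>k * (k - 1) div 2\<close>, which is the shift in the second factor on the left-hand
  side. It therefore suffices to multiply one product of falling factorials, with arbitrary
  exponents \<open>a i\<close>, by a falling power of \<open>\<Sum>i. x i - a i\<close>. Since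
  \[x^{\underline{a}} (x - a)^{\underline{r}} = x^{\underline{a + r}},\]
  the multinomial Chu-Vandermonde identity for the variables \<open>x i - a i\<close> expands that product in
  the basis of products \<open>\<Prod>i. ffact (x i) (m i)\<close>, with coefficients
  \[\frac{n!}{\prod_i (m_i - a_i)!} = n! \prod_i \frac{m_i^{\underline{a_i}}}{m_i!}\]
  (\<open>chu_vandermonde_shifted\<close>). The second form of the coefficient is also correct, namely zero,
  when some \<open>m i < a i\<close>, so that the same tuples \<open>m\<close> index the expansion for all \<open>p\<close>. Exchanging
  the sums over \<open>p\<close> and \<open>m\<close> leaves the alternating sum of \<open>\<Prod>i. ffact (m i) (p i)\<close> in the
  coefficient of each \<open>m\<close>, and \<open>vandermonde_ffact\<close> at the numbers \<open>m i\<close> contracts it to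
  \<open>\<Prod>i<j. m j - m i\<close>.

  The argument takes place in any commutative ring with a homomorphism from the rationals, through
  which the coefficients act; for polynomials this is the embedding of constants.
\<close>

section \<open>The Vandermonde product in falling factorials\<close>

text \<open>
  Newton interpolation, which changes the nodes from \<open>a\<close> to \<open>x\<close>: to multiply by \<open>y - a j\<close>, split
  it in the \<open>l\<close>-th term as \<open>(y - x l) + (x l - a j)\<close>; the first part passes to the next basis
  element, the second stays. That \<open>u\<close> vanishes beyond \<open>j\<close> with \<open>u j = 1\<close> makes the
  basis change unitriangular.
\<close>

lemma newton_basis_change:
  fixes a x :: "nat \<Rightarrow> 'a::comm_ring_1"
  shows "\<exists>u. u j = 1 \<and> (\<forall>l>j. u l = 0) \<and>
           (\<forall>y. (\<Prod>i<j. y - a i) = (\<Sum>l\<le>j. u l * (\<Prod>i<l. y - x i)))"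
proof (induction j)
  case 0
  show ?case by (rule exI[of _ "\<lambda>l. if l = 0 then 1 else 0"]) simp
next
  case (Suc j)
  then obtain u where u: "u j = 1" "\<forall>l>j. u l = 0"
    and exp: "\<And>y. (\<Prod>i<j. y - a i) = (\<Sum>l\<le>j. u l * (\<Prod>i<l. y - x i))"
    by blast
  define v where "v l = (if l = 0 then 0 else u (l - 1)) + (x l - a j) * u l" for l
  have "(\<Prod>i<Suc j. y - a i) = (\<Sum>l\<le>Suc j. v l * (\<Prod>i<l. y - x i))" for y
  proof -
    let ?N = "\<lambda>l. \<Prod>i<l. y - x i"
    have "(\<Prod>i<Suc j. y - a i) = (\<Sum>l\<le>j. u l * ?N l * (y - a j))"
      by (simp add: exp sum_distrib_right)
    also have "\<dots> = (\<Sum>l\<le>j. u l * ?N (Suc l) + (x l - a j) * u l * ?N l)"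
      by (intro sum.cong refl) (simp add: algebra_simps)
    also have "\<dots> = (\<Sum>l\<le>j. u l * ?N (Suc l)) + (\<Sum>l\<le>j. (x l - a j) * u l * ?N l)"
      by (rule sum.distrib)
    also have "(\<Sum>l\<le>j. u l * ?N (Suc l))
        = (\<Sum>l\<le>Suc j. (if l = 0 then 0 else u (l - 1)) * ?N l)"
      by (subst sum.atMost_Suc_shift) simp
    also have "(\<Sum>l\<le>j. (x l - a j) * u l * ?N l) = (\<Sum>l\<le>Suc j. (x l - a j) * u l * ?N l)"
      using u(2) by simp
    finally show ?thesis
      by (simp only: v_def distrib_right sum.distrib)
  qed
  then show ?case
    using u by (intro exI[of _ v]) (simp add: v_def)
qed

text \<open>
  The left-hand side is the determinant of the values at \<open>x i\<close> of the Newton basis with nodes \<open>a\<close>.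
  A unitriangular change of basis does not affect it, so the nodes may be taken to be the points
  \<open>x\<close> themselves, and then the matrix is triangular.
\<close>

lemma vandermonde_newton:
  fixes a x :: "nat \<Rightarrow> 'a::comm_ring_1"
  shows "(\<Sum>p | p permutes {0..<k}. signof p * (\<Prod>i=0..<k. \<Prod>l<p i. x i - a l))
           = (\<Prod>j=0..<k. \<Prod>i<j. x j - x i)"
proof -
  have "\<forall>j. \<exists>u. u j = 1 \<and> (\<forall>l>j. u l = 0) \<and>
          (\<forall>y. (\<Prod>i<j. y - a i) = (\<Sum>l\<le>j. u l * (\<Prod>i<l. y - x i)))"
    using newton_basis_change by blast
  then obtain u where u: "\<And>j. u j j = 1" "\<And>j l. l > j \<Longrightarrow> u j l = 0"
    and exp: "\<And>j y. (\<Prod>i<j. y - a i) = (\<Sum>l\<le>j. u j l * (\<Prod>i<l. y - x i))"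
    by metis
  define A where "A = mat k k (\<lambda>(i, j). \<Prod>l<j. x i - a l)"
  define N where "N = mat k k (\<lambda>(i, j). \<Prod>l<j. x i - x l)"
  define U where "U = mat k k (\<lambda>(l, j). u j l)"
  have carrier: "A \<in> carrier_mat k k" "N \<in> carrier_mat k k" "U \<in> carrier_mat k k"
    by (simp_all add: A_def N_def U_def)
  have "A = N * U"
  proof (rule eq_matI)
    fix i j assume "i < dim_row (N * U)" "j < dim_col (N * U)"
    then have ij: "i < k" "j < k" by (simp_all add: N_def U_def)
    have "(N * U) $$ (i, j) = (\<Sum>l=0..<k. (\<Prod>m<l. x i - x m) * u j l)"
      using ij by (simp add: N_def U_def scalar_prod_def)
    also have "\<dots> = (\<Sum>l\<le>j. u j l * (\<Prod>m<l. x i - x m))"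
      using ij u(2) by (intro sum.mono_neutral_cong_right) auto
    also have "\<dots> = A $$ (i, j)"
      using ij by (simp add: A_def exp)
    finally show "A $$ (i, j) = (N * U) $$ (i, j)" by simp
  qed (simp_all add: A_def N_def U_def)
  moreover have "det N = (\<Prod>j=0..<k. \<Prod>i<j. x j - x i)"
  proof -
    have "det N = prod_list (diag_mat N)"
    proof (rule det_lower_triangular[OF _ carrier(2)])
      fix i j assume "i < j" "j < k"
      then show "N $$ (i, j) = 0" by (auto simp: N_def intro!: prod_zero)
    qed
    then show ?thesis by (simp add: prod_list_diag_prod N_def)
  qed
  moreover have "det U = 1"
  proof -
    have "upper_triangular U" using u(2) by (auto simp: U_def)
    then have "det U = prod_list (diag_mat U)" by (rule det_upper_triangular[OF _ carrier(3)])
    then show ?thesis by (simp add: prod_list_diag_prod U_def u(1))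
  qed
  ultimately have "det A = (\<Prod>j=0..<k. \<Prod>i<j. x j - x i)"
    by (simp add: det_mult[OF carrier(2,3)])
  moreover have "det A
      = (\<Sum>p | p permutes {0..<k}. signof p * (\<Prod>i=0..<k. \<Prod>l<p i. x i - a l))"
    unfolding det_def'[OF carrier(1)]
    by (intro sum.cong refl arg_cong2[where f = "(*)"] prod.cong)
       (auto simp: A_def dest: permutes_in_image)
  ultimately show ?thesis by simp
qed

corollary vandermonde_ffact:
  fixes x :: "nat \<Rightarrow> 'a::comm_ring_1"
  shows "(\<Prod>j=1..k. \<Prod>i=1..<j. x j - x i)
           = (\<Sum>p | p permutes {0..<k}. signof p * (\<Prod>i=1..k. ffact (x i) (p (i - 1))))"
proof -
  have shift: "(\<Prod>i=1..k. f i) = (\<Prod>i=0..<k. f (Suc i))" for f :: "nat \<Rightarrow> 'a"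
    using prod.shift_bounds_Suc_ivl[of f 0 k] by (simp add: atLeastLessThanSuc_atLeastAtMost)
  have "(\<Prod>i=1..<Suc j. x (Suc j) - x i) = (\<Prod>i<j. x (Suc j) - x (Suc i))" for j
    using prod.shift_bounds_Suc_ivl[of "\<lambda>i. x (Suc j) - x i" 0 j] by (simp add: lessThan_atLeast0)
  then show ?thesis
    unfolding shift using vandermonde_newton[where a = of_nat and x = "\<lambda>i. x (Suc i)"]
    by (simp add: ffact_def)
qed

section \<open>A shifted multinomial Chu-Vandermonde identity\<close>

lemma ffact_Suc: "ffact x (Suc n) = ffact x n * (x - of_nat n)"
  by (simp add: ffact_def)

lemma ffact_Suc_left: "ffact x (Suc n) = x * ffact (x - 1) n"
  unfolding ffact_def
  by (subst prod.lessThan_Suc_shift) (simp add: algebra_simps)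

lemma ffact_of_nat_eq_0: "m < n \<Longrightarrow> ffact (of_nat m) n = 0"
  unfolding ffact_def by (intro prod_zero bexI[of _ m]) auto

lemma ffact_of_nat_self: "ffact (of_nat n) n = fact n"
proof (induction n)
  case (Suc n)
  then show ?case by (subst ffact_Suc_left) simp
qed (simp add: ffact_def)

text \<open>
  The quotient \<open>ffact m a / fact m\<close> is \<open>1 / fact (m - a)\<close>, read as zero for \<open>m < a\<close>. So this is
  the recurrence \<open>r / fact r = 1 / fact (r - 1)\<close> for \<open>r = m - a\<close>, in a form that also covers
  negative \<open>r\<close>.
\<close>

lemma ffact_div_fact_pred:
  "(of_nat m - of_nat a) * (ffact (of_nat m) a / fact m)
     = (if m = 0 then 0 else ffact (of_nat (m - 1)) a / fact (m - 1) :: rat)"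
proof (cases m)
  case 0
  then show ?thesis using ffact_of_nat_eq_0[of 0 a, where ?'a = rat] by (cases a) auto
next
  case (Suc l)
  have "(of_nat m - of_nat a) * ffact (of_nat m :: rat) a = of_nat m * ffact (of_nat l) a"
    using ffact_Suc[of "of_nat m :: rat" a] ffact_Suc_left[of "of_nat m :: rat" a] Suc
    by (simp add: mult.commute)
  then have "(of_nat m - of_nat a) * (ffact (of_nat m) a / fact m)
      = of_nat m * ffact (of_nat l) a / (fact m :: rat)" by simp
  also have "\<dots> = ffact (of_nat l) a / fact l"
    using Suc by (simp del: of_nat_Suc)
  finally show ?thesis using Suc by simp
qed

lemma prod_fun_upd_pointwise:
  assumes "finite A" "i \<in> A"
  shows "(\<Prod>j\<in>A. f j ((m(i := b)) j)) = f i b * (\<Prod>j\<in>A - {i}. f j (m j))"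
proof -
  have "(\<Prod>j\<in>A. f j ((m(i := b)) j)) = f i b * (\<Prod>j\<in>A - {i}. f j ((m(i := b)) j))"
    using assms by (subst prod.remove) auto
  also have "(\<Prod>j\<in>A - {i}. f j ((m(i := b)) j)) = (\<Prod>j\<in>A - {i}. f j (m j))"
    by (intro prod.cong) auto
  finally show ?thesis .
qed

lemma tuples_with_sum_raise:
  assumes "i \<in> {1..k}" "m \<in> tuples_with_sum k s"
  shows "m(i := Suc (m i)) \<in> tuples_with_sum k (Suc s)"
  using assms by (auto simp: tuples_with_sum_def PiE_iff extensional_def sum.remove)

lemma tuples_with_sum_lower:
  assumes "i \<in> {1..k}" "m \<in> tuples_with_sum k (Suc s)" "m i > 0"
  shows "m(i := m i - 1) \<in> tuples_with_sum k s"
  using assms by (auto simp: tuples_with_sum_def PiE_iff extensional_def sum.remove)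

text \<open>
  Raising the \<open>i\<close>-th entry is a bijection from the tuples of sum \<open>s\<close> onto those of sum \<open>Suc s\<close>
  with a nonzero \<open>i\<close>-th entry. The two arguments of \<open>h\<close> are the lower and the raised tuple.
\<close>

lemma sum_raise_eq_sum_lower:
  fixes h :: "(nat \<Rightarrow> nat) \<Rightarrow> (nat \<Rightarrow> nat) \<Rightarrow> 'a::comm_monoid_add"
  shows "(\<Sum>m\<in>tuples_with_sum k s. \<Sum>i=1..k. h m (m(i := Suc (m i))))
       = (\<Sum>m\<in>tuples_with_sum k (Suc s). \<Sum>i=1..k. if m i = 0 then 0 else h (m(i := m i - 1)) m)"
proof -
  let ?T = "tuples_with_sum k s" and ?T' = "tuples_with_sum k (Suc s)"
  have "(\<Sum>m\<in>?T. \<Sum>i=1..k. h m (m(i := Suc (m i))))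
      = (\<Sum>(m, i)\<in>?T \<times> {1..k}. h m (m(i := Suc (m i))))"
    by (simp add: sum.cartesian_product)
  also have "\<dots> = (\<Sum>(m, i)\<in>{(m, i) \<in> ?T' \<times> {1..k}. m i > 0}. h (m(i := m i - 1)) m)"
    by (rule sum.reindex_bij_witness[where j = "\<lambda>(m, i). (m(i := Suc (m i)), i)"
          and i = "\<lambda>(m, i). (m(i := m i - 1), i)"])
       (auto intro: tuples_with_sum_raise tuples_with_sum_lower[simplified])
  also have "\<dots> = (\<Sum>(m, i)\<in>?T' \<times> {1..k}. if m i = 0 then 0 else h (m(i := m i - 1)) m)"
    by (intro sum.mono_neutral_cong_left) (auto simp: finite_tuples_with_sum split: if_splits)
  finally show ?thesis by (simp add: sum.cartesian_product)
qed

lemma tuple_of_same_sum_dips_below: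
  assumes "m \<in> tuples_with_sum k (\<Sum>i=1..k. a i)" "m \<noteq> restrict a {1..k}"
  shows "\<exists>i\<in>{1..k}. m i < a i"
proof (rule ccontr)
  assume "\<not> ?thesis"
  then have le: "\<And>i. i \<in> {1..k} \<Longrightarrow> a i \<le> m i" by force
  have sum: "(\<Sum>i=1..k. a i) = (\<Sum>i=1..k. m i)"
    and ext: "m \<in> extensional {1..k}"
    using assms(1) by (auto simp: tuples_with_sum_def PiE_iff)
  have "m i = restrict a {1..k} i" if "i \<in> {1..k}" for i
    using sum_mono_inv[OF sum le that] that by simp
  then have "m = restrict a {1..k}"
    using ext by (intro extensionalityI[of m "{1..k}"]) auto
  with assms(2) show False by simp
qed

text \<open>
  Induction on \<open>n\<close>. On tuples \<open>m\<close> of the relevant sum, the new factor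
  \<open>(\<Sum>i. x i) - (\<Sum>i. a i) - n\<close> equals \<open>\<Sum>i. x i - m i\<close>, and multiplying the product of falling
  factorials by \<open>x i - m i\<close> raises \<open>m i\<close> by one. Collecting the contributions to a given tuple,
  the coefficients satisfy the required recurrence by \<open>ffact_div_fact_pred\<close>, because the
  differences \<open>m i - a i\<close> there add up to \<open>Suc n\<close>. For \<open>n = 0\<close> only the tuple \<open>a\<close> has a nonzero
  coefficient.
\<close>

lemma chu_vandermonde_shifted:
  fixes c :: "rat \<Rightarrow> 'a::comm_ring_1" and x :: "nat \<Rightarrow> 'a" and a :: "nat \<Rightarrow> nat"
  assumes "comm_ring_hom c"
  shows "(\<Prod>i=1..k. ffact (x i) (a i)) * ffact ((\<Sum>i=1..k. x i) - of_nat (\<Sum>i=1..k. a i)) n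
       = (\<Sum>m\<in>tuples_with_sum k (n + (\<Sum>i=1..k. a i)).
            c (fact n * (\<Prod>i=1..k. ffact (of_nat (m i)) (a i) / fact (m i)))
              * (\<Prod>i=1..k. ffact (x i) (m i)))"
proof (induction n)
  interpret comm_ring_hom c by fact
  case 0
  let ?a = "restrict a {1..k}"
  have "(\<Sum>m\<in>tuples_with_sum k (\<Sum>i=1..k. a i).
            c (\<Prod>i=1..k. ffact (of_nat (m i)) (a i) / fact (m i)) * (\<Prod>i=1..k. ffact (x i) (m i)))
      = (\<Sum>m\<in>{?a}.
            c (\<Prod>i=1..k. ffact (of_nat (m i)) (a i) / fact (m i)) * (\<Prod>i=1..k. ffact (x i) (m i)))"
  proof (rule sum.mono_neutral_right[OF finite_tuples_with_sum])
    show "{?a} \<subseteq> tuples_with_sum k (\<Sum>i=1..k. a i)"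
      by (auto simp: tuples_with_sum_def)
    show "\<forall>m\<in>tuples_with_sum k (\<Sum>i=1..k. a i) - {?a}.
        c (\<Prod>i=1..k. ffact (of_nat (m i)) (a i) / fact (m i)) * (\<Prod>i=1..k. ffact (x i) (m i)) = 0"
    proof
      fix m assume "m \<in> tuples_with_sum k (\<Sum>i=1..k. a i) - {?a}"
      then obtain i where "i \<in> {1..k}" "m i < a i"
        using tuple_of_same_sum_dips_below by blast
      then have "(\<Prod>i=1..k. ffact (of_nat (m i)) (a i) / fact (m i) :: rat) = 0"
        by (intro prod_zero bexI[of _ i]) (auto simp: ffact_of_nat_eq_0)
      then show "c (\<Prod>i=1..k. ffact (of_nat (m i)) (a i) / fact (m i))
          * (\<Prod>i=1..k. ffact (x i) (m i)) = 0"
        by (simp only: hom_zero mult_zero_left)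
    qed
  qed
  also have "\<dots> = (\<Prod>i=1..k. ffact (x i) (a i))"
    by (simp add: ffact_of_nat_self)
  finally show ?case
    by (simp add: ffact_def)
next
  interpret comm_ring_hom c by fact
  case (Suc n)
  define s where "s = (\<Sum>i=1..k. a i)"
  define S where "S = (\<Sum>i=1..k. x i) - of_nat s"
  define g :: "(nat \<Rightarrow> nat) \<Rightarrow> rat"
    where "g m = (\<Prod>i=1..k. ffact (of_nat (m i)) (a i) / fact (m i))" for m
  define F where "F m = (\<Prod>i=1..k. ffact (x i) (m i))" for m
  let ?T = "tuples_with_sum k"
  have raise: "F m * (S - of_nat n) = (\<Sum>i=1..k. F (m(i := Suc (m i))))"
    if m: "m \<in> ?T (n + s)" for m
  proof -
    have "(\<Sum>i=1..k. m i) = n + s" using m by (simp add: tuples_with_sum_def)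
    then have "of_nat (n + s) = (\<Sum>i=1..k. of_nat (m i) :: 'a)"
      by (metis of_nat_sum)
    then have "S - of_nat n = (\<Sum>i=1..k. x i - of_nat (m i))"
      by (simp add: S_def sum_subtractf algebra_simps)
    moreover have "F m * (x i - of_nat (m i)) = F (m(i := Suc (m i)))" if "i \<in> {1..k}" for i
      using prod_fun_upd_pointwise[OF _ that, of "\<lambda>j. ffact (x j)" m]
        prod.remove[OF _ that, of "\<lambda>j. ffact (x j) (m j)"]
      by (simp add: F_def ffact_Suc mult_ac)
    ultimately show ?thesis by (simp add: sum_distrib_left)
  qed
  have lower: "of_nat (Suc n) * g m = (\<Sum>i=1..k. if m i = 0 then 0 else g (m(i := m i - 1)))"
    if m: "m \<in> ?T (Suc (n + s))" for m
  proof -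
    have "(\<Sum>i=1..k. m i) = Suc n + s" using m by (simp add: tuples_with_sum_def)
    then have "of_nat (Suc n + s) = (\<Sum>i=1..k. of_nat (m i) :: rat)"
      by (metis of_nat_sum)
    moreover have "of_nat s = (\<Sum>i=1..k. of_nat (a i) :: rat)" by (simp add: s_def)
    ultimately have "of_nat (Suc n) = (\<Sum>i=1..k. of_nat (m i) - of_nat (a i) :: rat)"
      by (simp only: sum_subtractf of_nat_add)
    moreover have "(of_nat (m i) - of_nat (a i)) * g m
        = (if m i = 0 then 0 else g (m(i := m i - 1)))" if i: "i \<in> {1..k}" for i
    proof -
      let ?f = "\<lambda>j b. ffact (of_nat b) (a j) / fact b :: rat"
      have "(of_nat (m i) - of_nat (a i)) * g m
          = (of_nat (m i) - of_nat (a i)) * ?f i (m i) * (\<Prod>j\<in>{1..k} - {i}. ?f j (m j))"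
        unfolding g_def using prod.remove[OF _ i, of "\<lambda>j. ?f j (m j)"] by (simp add: mult.assoc)
      also have "\<dots> = (if m i = 0 then 0 else g (m(i := m i - 1)))"
        unfolding ffact_div_fact_pred g_def
        using prod_fun_upd_pointwise[OF _ i, of ?f m "m i - 1"] by simp
      finally show ?thesis .
    qed
    ultimately show ?thesis by (simp add: sum_distrib_right)
  qed
  have "(\<Prod>i=1..k. ffact (x i) (a i)) * ffact S (Suc n)
      = (\<Sum>m\<in>?T (n + s). c (fact n * g m) * (F m * (S - of_nat n)))"
    using Suc by (simp only: ffact_Suc mult.assoc [symmetric] S_def s_def g_def F_def
        sum_distrib_right)
  also have "\<dots> = (\<Sum>m\<in>?T (n + s). \<Sum>i=1..k. c (fact n * g m) * F (m(i := Suc (m i))))"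
    by (simp add: raise sum_distrib_left cong: sum.cong)
  also have "\<dots> = (\<Sum>m\<in>?T (Suc (n + s)). \<Sum>i=1..k.
                   if m i = 0 then 0 else c (fact n * g (m(i := m i - 1))) * F m)"
    by (rule sum_raise_eq_sum_lower)
  also have "\<dots> = (\<Sum>m\<in>?T (Suc (n + s)). c (fact (Suc n) * g m) * F m)"
  proof (rule sum.cong[OF refl])
    fix m assume "m \<in> ?T (Suc (n + s))"
    then have "fact (Suc n) * g m = fact n * (\<Sum>i=1..k. if m i = 0 then 0 else g (m(i := m i - 1)))"
      by (simp only: lower[symmetric] fact_Suc of_nat_id mult_ac)
    also have "\<dots> = (\<Sum>i=1..k. if m i = 0 then 0 else fact n * g (m(i := m i - 1)))"
      by (auto simp: sum_distrib_left intro!: sum.cong)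
    finally have "c (fact (Suc n) * g m)
        = (\<Sum>i=1..k. c (if m i = 0 then 0 else fact n * g (m(i := m i - 1))))"
      by (simp only: hom_sum)
    then show "(\<Sum>i=1..k. if m i = 0 then 0 else c (fact n * g (m(i := m i - 1))) * F m)
        = c (fact (Suc n) * g m) * F m"
      by (auto simp: sum_distrib_right intro!: sum.cong)
  qed
  finally show ?case by (simp add: S_def s_def g_def F_def)
qed

section \<open>The product formula\<close>

text \<open>
  Both Vandermonde products, the one in \<open>x\<close> and the one in the tuple \<open>m\<close>, arise from the same
  signed sum over permutations, before and after the expansion by \<open>chu_vandermonde_shifted\<close>.
\<close>

lemma vandermonde_times_ffact_sum:
  fixes c :: "rat \<Rightarrow> 'a::comm_ring_1" and x :: "nat \<Rightarrow> 'a"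
  assumes "comm_ring_hom c"
  shows "(\<Prod>j=1..k. \<Prod>i=1..<j. x j - x i)
           * ffact ((\<Sum>i=1..k. x i) - of_nat (k * (k - 1) div 2)) n
       = (\<Sum>m\<in>tuples_with_sum k (n + k * (k - 1) div 2).
            c (fact n / (\<Prod>i=1..k. fact (m i))
                 * (\<Prod>j=1..k. \<Prod>i=1..<j. of_nat (m j) - of_nat (m i)))
              * (\<Prod>i=1..k. ffact (x i) (m i)))"
proof -
  interpret comm_ring_hom c by fact
  define s where "s = k * (k - 1) div 2"
  let ?P = "{p. p permutes {0..<k}}" and ?T = "tuples_with_sum k (n + s)"
  define F where "F m = (\<Prod>i=1..k. ffact (x i) (m i))" for m
  define w :: "(nat \<Rightarrow> nat) \<Rightarrow> (nat \<Rightarrow> nat) \<Rightarrow> rat"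
    where "w p m = fact n * (\<Prod>i=1..k. ffact (of_nat (m i)) (p (i - 1)) / fact (m i))" for p m
  \<comment> \<open>The exponent sum does not depend on the permutation, so one shift and one set of tuples
    serve all of them.\<close>
  have s: "(\<Sum>i=1..k. p (i - 1)) = s" if p: "p permutes {0..<k}" for p
  proof -
    have "(\<Sum>i=1..k. p (i - 1)) = (\<Sum>i=0..<k. p i)"
      using sum.shift_bounds_Suc_ivl[of "\<lambda>i. p (i - 1)" 0 k]
      by (simp add: atLeastLessThanSuc_atLeastAtMost)
    also have "\<dots> = \<Sum>{0..<k}" using sum.permute[OF p, of "\<lambda>i. i"] by (simp add: o_def)
    also have "\<dots> = s" by (simp add: Sum_Ico_nat s_def)
    finally show ?thesis .
  qed
  have "(\<Prod>j=1..k. \<Prod>i=1..<j. x j - x i) * ffact ((\<Sum>i=1..k. x i) - of_nat s) n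
      = (\<Sum>p\<in>?P. signof p * ((\<Prod>i=1..k. ffact (x i) (p (i - 1)))
                               * ffact ((\<Sum>i=1..k. x i) - of_nat s) n))"
    by (simp only: vandermonde_ffact sum_distrib_right mult.assoc)
  also have "\<dots> = (\<Sum>p\<in>?P. signof p * (\<Sum>m\<in>?T. c (w p m) * F m))"
  proof (intro sum.cong refl arg_cong2[where f = "(*)"])
    fix p assume "p \<in> ?P"
    then show "(\<Prod>i=1..k. ffact (x i) (p (i - 1))) * ffact ((\<Sum>i=1..k. x i) - of_nat s) n
        = (\<Sum>m\<in>?T. c (w p m) * F m)"
      using chu_vandermonde_shifted[OF assms, where k = k and x = x
          and a = "\<lambda>i. p (i - 1)" and n = n]
      by (simp only: s[of p] mem_Collect_eq F_def w_def)
  qed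
  also have "\<dots> = (\<Sum>m\<in>?T. \<Sum>p\<in>?P. c (signof p * w p m) * F m)"
    by (subst sum.swap) (simp add: sum_distrib_left hom_mult mult.assoc)
  also have "\<dots> = (\<Sum>m\<in>?T. c (\<Sum>p\<in>?P. signof p * w p m) * F m)"
    by (simp add: hom_sum sum_distrib_right)
  finally have "(\<Prod>j=1..k. \<Prod>i=1..<j. x j - x i) * ffact ((\<Sum>i=1..k. x i) - of_nat s) n
      = (\<Sum>m\<in>?T. c (\<Sum>p\<in>?P. signof p * w p m) * F m)" .
  moreover have "(\<Sum>p\<in>?P. signof p * w p m) = fact n / (\<Prod>i=1..k. fact (m i))
                 * (\<Prod>j=1..k. \<Prod>i=1..<j. of_nat (m j) - of_nat (m i))" for m
    unfolding vandermonde_ffact sum_distrib_left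
    by (intro sum.cong refl) (simp add: w_def prod_dividef)
  ultimately show ?thesis by (simp only: F_def s_def)
qed

lemma comm_ring_hom_Const: "comm_ring_hom Const"
  by unfold_locales (simp_all add: Const_def single_add mult_single)

theorem theorem3:
  fixes k n :: nat
  assumes "k \<ge> 1"
  shows "(\<Prod>j=1..k. \<Prod>i=1..<j. X j - X i)
           * ffact ((\<Sum>i=1..k. X i) - Const (of_nat k * (of_nat k - 1) / 2)) n
       = (\<Sum>m\<in>tuples_with_sum k (n + k * (k - 1) div 2).
            Const (fact n / (\<Prod>i=1..k. fact (m i))
                     * (\<Prod>j=1..k. \<Prod>i=1..<j. of_nat (m j) - of_nat (m i)))
              * (\<Prod>i=1..k. ffact (X i) (m i)))"
proof -
  interpret Const: comm_ring_hom Const by (rule comm_ring_hom_Const)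
  have "of_nat (k * (k - 1) div 2) = (of_nat k * (of_nat k - 1) / 2 :: rat)"
    using assms by (simp add: of_nat_diff field_char_0_class.of_nat_div)
  then have "Const (of_nat k * (of_nat k - 1) / 2) = of_nat (k * (k - 1) div 2)"
    by (metis Const.hom_of_nat)
  then show ?thesis
    using vandermonde_times_ffact_sum[OF comm_ring_hom_Const] by simp
qed

end
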